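(* Let $\{x_{i,k}\}$, $i\in\{1,\dots,m\}$, $k\ge 1$, be generated by the distributed proximal gradient algorithm described in the context, with arbitrary initial points $x_{i,1}\in\mathbb{R}^n$, and suppose that the problem assumptions (P-a)–(P-e) and the network assumptions (N-a)–(N-c) of the context hold. Let $\bar x_k=\frac1m\sum_{i=1}^m x_{i,k}$. Then $$\lim_{k\to\infty}\|x_{i,k}-\bar x_k\|=0\quad\text{for all } i=1,\dots,m.$$
   Context: **Problem.** There are $m$ agents. Consider $\min_{x\in\mathbb{R}^n} f(x)=\frac1m\sum_{i=1}^m\big(g_i(x)+h(x)\big)$, where $g_i:\mathbb{R}^n\to\mathbb{R}$ is differentiable (possibly non-convex) and $h:\mathbb{R}^n\to(-\infty,\infty]$ is closed, proper, convex and possibly non-smooth. $\|\cdot\|$ is the Euclidean norm. **Problem assumptions.** (P-a) Each $g_i$ is continuously differentiable and $\|\nabla g_i(x)-\nabla g_i(y)\|\le L\|x-y\|$ for all $x,y$, with a common constant $L>0$. (P-b) $h$ is convex. (P-c) There is a scalar $G_g$ with $\|\nabla g_i(x)\|<G_g$ for all $i$ and all $x$. (P-d) There is a scalar $G_h$ with $\|z\|<G_h$ for every $x$ and every subgradient $z\in\partial h(x)$. (P-e) The problem has at least one optimal solution $x^*$. **Network.** At each time $t=1,2,\dots$ the agents communicate over an undirected graph with vertex set $\{1,\dots,m\}$, edge set $\mathcal{E}(t)$ and symmetric adjacency (weight) matrix $A(t)=[a_{ij}(t)]\in\mathbb{R}^{m\times m}$. **Network assumptions.** (N-a) Each $A(t)$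 is doubly stochastic. (N-b) There is $\eta\in(0,1)$ such that $a_{ii}(t)\ge\eta$ for all $i,t$; and for $i\neq j$, $a_{ij}(t)\ge\eta$ if $\{i,j\}\in\mathcal{E}(t)$ and $a_{ij}(t)=0$ otherwise. (N-c) The graph sequence is uniformly connected: each agent $j$ receives information from each agent $i$ for infinitely many $t$, and there is an integer $B\ge1$ such that each agent $i$ sends its information to all other agents at least once every $B$ consecutive time slots (i.e. for all $i\ne j$ and all $t$, $\{i,j\}\in\mathcal{E}(s)$ for some $s\in\{t,\dots,t+B-1\}$). **Proximal operator.** For $\alpha>0$, $\mathrm{prox}_{\alpha,h}(x)=\mathrm{argmin}_{z\in\mathbb{R}^n}\{h(z)+\frac{1}{2\alpha}\|z-x\|^2\}$. **Algorithm.** Fix a constant step-size $0<\alpha<\frac1L$. For $i\in\{1,\dots,m\}$ and $k=1,2,\dots$: $$q_{i,k+1}=x_{i,k}-\alpha\nabla g_i(x_{i,k}),\qquad v_{i,k+1}=\sum_{j=1}^m\lambda_{ij,k+1}\,q_{j,k+1},\qquad x_{i,k+1}=\mathrm{prox}_{\alpha,h}(v_{i,k+1}),$$ where $\lambda_{ij,k}=\big[\Phi(t(k)+k,t(k))\big]_{ij}$, $\Phi(t,s)=A(t)A(t-1)\cdots A(s+1)A(s)$ for $t>s\ge0$, and $t(k)$ is the total number of communication steps before iteration $k$; since $k$ communication steps are performed at iteration $k$, $t(k)=\sum_{l=1}^{k-1}l=\frac{k(k-1)}2$. *)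

theory Defs
  imports "HOL-Analysis.Analysis"
begin

section \<open>Convex analysis for extended-real-valued functions\<close>

definition ext_epigraph :: "('a \<Rightarrow> ereal) \<Rightarrow> ('a \<times> real) set" where
  "ext_epigraph h = {(x, r). h x \<le> ereal r}"

definition closed_fun :: "('a::real_normed_vector \<Rightarrow> ereal) \<Rightarrow> bool" where
  "closed_fun h \<longleftrightarrow> closed (ext_epigraph h)"

definition convex_fun :: "('a::real_vector \<Rightarrow> ereal) \<Rightarrow> bool" where
  "convex_fun h \<longleftrightarrow> convex (ext_epigraph h)"

definition proper_fun :: "('a \<Rightarrow> ereal) \<Rightarrow> bool" where
  "proper_fun h \<longleftrightarrow> (\<forall>x. h x \<noteq> - \<infinity>) \<and> (\<exists>x. h x \<noteq> \<infinity>)"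

text \<open>For a proper \<open>h\<close> the set below is empty wherever \<open>h x = \<infinity>\<close>, as usual.\<close>

definition subdifferential :: "('a::real_inner \<Rightarrow> ereal) \<Rightarrow> 'a \<Rightarrow> 'a set" where
  "subdifferential h x = {z. \<forall>y. h y \<ge> h x + ereal (z \<bullet> (y - x))}"

definition prox :: "real \<Rightarrow> ('a::real_normed_vector \<Rightarrow> ereal) \<Rightarrow> 'a \<Rightarrow> 'a" where
  "prox \<alpha> h x = arg_min (\<lambda>z. h z + ereal (1 / (2 * \<alpha>) * (norm (z - x))\<^sup>2)) (\<lambda>_. True)"

definition gradient :: "('a::real_inner \<Rightarrow> real) \<Rightarrow> 'a \<Rightarrow> 'a" where
  "gradient f x = (THE D. GDERIV f x :> D)"


section \<open>The multi-agent problem\<close>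

text \<open>The agents are the elements of a finite type \<open>'m\<close>, so that \<open>m = CARD('m)\<close>.\<close>

definition objective ::
  "('m::finite \<Rightarrow> 'a \<Rightarrow> real) \<Rightarrow> ('a \<Rightarrow> ereal) \<Rightarrow> 'a \<Rightarrow> ereal" where
  "objective g h x = ereal (1 / real CARD('m)) * (\<Sum>i\<in>UNIV. ereal (g i x) + h x)"

definition agent_mean :: "('m::finite \<Rightarrow> nat \<Rightarrow> 'a::real_vector) \<Rightarrow> nat \<Rightarrow> 'a" where
  "agent_mean x k = (1 / real CARD('m)) *\<^sub>R (\<Sum>i\<in>UNIV. x i k)"


section \<open>Network weights\<close>

definition doubly_stochastic :: "real^'m^'m \<Rightarrow> bool" where
  "doubly_stochastic M \<longleftrightarrow>
     (\<forall>i j. M $ i $ j \<ge> 0) \<and> (\<forall>i. (\<Sum>j\<in>UNIV. M $ i $ j) = 1) \<and> (\<forall>j. (\<Sum>i\<in>UNIV. M $ i $ j) = 1)"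

text \<open>\<open>transition A t s = A t ** A (t - 1) ** \<dots> ** A (s + 1) ** A s\<close> for \<open>t \<ge> s\<close>;
  the value for \<open>t < s\<close> is a dummy.\<close>

fun transition :: "(nat \<Rightarrow> real^'m^'m) \<Rightarrow> nat \<Rightarrow> nat \<Rightarrow> real^'m^'m" where
  "transition A 0 s = A s"
| "transition A (Suc t) s = (if s \<le> t then A (Suc t) ** transition A t s else A s)"

definition comm_steps :: "nat \<Rightarrow> nat" where
  "comm_steps k = (\<Sum>l = 1..k - 1. l)"

definition weight :: "(nat \<Rightarrow> real^'m^'m) \<Rightarrow> 'm \<Rightarrow> 'm \<Rightarrow> nat \<Rightarrow> real" where
  "weight A i j k = transition A (comm_steps k + k) (comm_steps k) $ i $ j"

end

(* The prox subproblem has a minimiser because the existence of an optimum, together with the bounded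
   gradients of the g_i, yields a minorant a - G |z - y| of h, so closedness makes the relevant
   sublevel set of the epigraph compact. The bound on subgradients gives |prox y - y| <= alpha G_h, and
   hence the iterates grow at most linearly in k. The prox is nonexpansive, so |x_i - x_j| is at most the
   spread of the mixing weights times the size of the q_l. The weights at iteration k come from a
   product of k + 1 matrices; every block of B of them has entries at least eta^B and so shrinks
   the spread by the factor 1 - eta^B. Geometric decay beats linear growth. *)
theory Submission imports Defs begin

section \<open>Proximal points\<close>

text \<open>Minimising over the epigraph replaces the extended-real objective by the continuous real
  function \<open>\<phi>\<close> on a closed set, where the extreme value theorem applies. The
  sublevel set is bounded because the quadratic term outgrows the linear minorant.\<close>

lemma prox_minimizer_exists:
  fixes h :: "'a::euclidean_space \<Rightarrow> ereal"
  assumes "closed_fun h" "proper_fun h" "\<alpha> > 0"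
    and minorant: "\<And>z. ereal (a - G * norm (z - x)) \<le> h z"
  shows "\<exists>p. is_arg_min (\<lambda>z. h z + ereal (1 / (2 * \<alpha>) * (norm (z - x))\<^sup>2)) (\<lambda>_. True) p"
proof -
  define \<phi> where "\<phi> = (\<lambda>(z::'a, r::real). r + 1 / (2 * \<alpha>) * (norm (z - x))\<^sup>2)"
  obtain y where "h y \<noteq> \<infinity>" "h y \<noteq> - \<infinity>"
    using assms(2) by (auto simp: proper_fun_def)
  then obtain r\<^sub>y where ry: "h y = ereal r\<^sub>y" by (cases "h y") auto
  define c where "c = \<phi> (y, r\<^sub>y)"
  define S where "S = ext_epigraph h \<inter> {u. \<phi> u \<le> c}"
  have cont: "continuous_on UNIV \<phi>"
    unfolding \<phi>_def case_prod_beta by (intro continuous_intros)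
  have "closed {u. \<phi> u \<le> c}"
    by (intro closed_Collect_le cont continuous_intros)
  then have "closed S"
    using assms(1) unfolding S_def closed_fun_def by blast
  have S_D: "a - G * norm (z - x) \<le> r" "r + 1 / (2 * \<alpha>) * (norm (z - x))\<^sup>2 \<le> c"
    if "(z, r) \<in> S" for z r
    using that order_trans[OF minorant, of z "ereal r"]
    by (auto simp: S_def ext_epigraph_def \<phi>_def)
  \<comment> \<open>With \<open>n = norm (z - x)\<close>, membership in \<open>S\<close> gives
    \<open>n^2 \<le> 2 \<alpha> (c - a) + 2 \<alpha> G n\<close>. For \<open>n \<ge> 1\<close> the
    right side is at most \<open>(D - 1) n\<close>, which excludes \<open>n > D\<close>. The
    absolute values cover either sign of \<open>c - a\<close> and of \<open>G\<close>.\<close>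
  define D where "D = \<bar>2 * \<alpha> * (c - a)\<bar> + \<bar>2 * \<alpha> * G\<bar> + 1"
  have bz: "norm (z - x) \<le> D" if "(z, r) \<in> S" for z r
  proof (rule ccontr)
    assume "\<not> norm (z - x) \<le> D"
    then have gt: "norm (z - x) > D" by simp
    let ?n = "norm (z - x)"
    have "?n\<^sup>2 / (2 * \<alpha>) \<le> c - a + G * ?n"
      using S_D[OF that] by simp
    then have "?n\<^sup>2 \<le> 2 * \<alpha> * (c - a) + 2 * \<alpha> * G * ?n"
      using \<open>\<alpha> > 0\<close> by (simp add: field_simps)
    also have "\<dots> \<le> \<bar>2 * \<alpha> * (c - a)\<bar> * ?n + \<bar>2 * \<alpha> * G\<bar> * ?n"
    proof (intro add_mono mult_right_mono)
      have "?n \<ge> 1" using gt unfolding D_def by linarith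
      then have "\<bar>2 * \<alpha> * (c - a)\<bar> * 1 \<le> \<bar>2 * \<alpha> * (c - a)\<bar> * ?n"
        by (intro mult_left_mono) auto
      then show "2 * \<alpha> * (c - a) \<le> \<bar>2 * \<alpha> * (c - a)\<bar> * ?n" by linarith
    qed auto
    also have "\<dots> < D * ?n"
    proof -
      have "?n > 0" using gt unfolding D_def by linarith
      then show ?thesis unfolding D_def by (simp add: algebra_simps)
    qed
    also have "\<dots> < ?n * ?n"
      using gt by (intro mult_strict_right_mono) (auto simp: D_def)
    finally show False by (simp add: power2_eq_square)
  qed
  have "S \<subseteq> cball x D \<times> {a - \<bar>G\<bar> * D..c}"
  proof (clarsimp, intro conjI)
    fix z r assume zr: "(z, r) \<in> S"
    show "dist x z \<le> D" using bz[OF zr] by (simp add: dist_norm norm_minus_commute)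
    have "G * norm (z - x) \<le> \<bar>G\<bar> * D"
      by (rule order_trans[OF mult_right_mono mult_left_mono]) (use bz[OF zr] in auto)
    then show "a - \<bar>G\<bar> * D \<le> r" using S_D[OF zr] by linarith
    have "1 / (2 * \<alpha>) * (norm (z - x))\<^sup>2 \<ge> 0" using \<open>\<alpha> > 0\<close> by simp
    then show "r \<le> c" using S_D[OF zr] by linarith
  qed
  then have "bounded S"
    by (rule bounded_subset[rotated]) (intro bounded_Times bounded_cball bounded_closed_interval)
  then have "compact S" using \<open>closed S\<close> by (simp add: compact_eq_bounded_closed)
  moreover have yS: "(y, r\<^sub>y) \<in> S" by (simp add: S_def ext_epigraph_def ry c_def)
  ultimately obtain u where "u \<in> S" and umin: "\<And>w. w \<in> S \<Longrightarrow> \<phi> u \<le> \<phi> w"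
    using continuous_attains_inf[of S \<phi>] continuous_on_subset[OF cont] by blast
  obtain p r where u: "u = (p, r)" by (cases u)
  \<comment> \<open>Points of the epigraph outside \<open>S\<close> have a value above
    \<open>c\<close>, which is the value at the reference point \<open>(y, r\<^sub>y)\<close> of
    \<open>S\<close>; hence minimality extends from \<open>S\<close> to the whole epigraph.\<close>
  have le: "\<phi> (p, r) \<le> \<phi> w" if "w \<in> ext_epigraph h" for w
  proof (cases "\<phi> w \<le> c")
    case True
    then show ?thesis using umin that u by (simp add: S_def)
  next
    case False
    then show ?thesis using umin[OF yS] u by (simp add: c_def)
  qed
  have hp: "h p \<le> ereal r" using \<open>u \<in> S\<close> u by (simp add: S_def ext_epigraph_def)
  have "h p + ereal (1 / (2 * \<alpha>) * (norm (p - x))\<^sup>2)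
          \<le> h z + ereal (1 / (2 * \<alpha>) * (norm (z - x))\<^sup>2)" for z
  proof (cases "h z")
    case (real s)
    then have "\<phi> (p, r) \<le> \<phi> (z, s)" by (intro le) (simp add: ext_epigraph_def)
    then have "ereal (\<phi> (p, r)) \<le> h z + ereal (1 / (2 * \<alpha>) * (norm (z - x))\<^sup>2)"
      using real by (simp add: \<phi>_def)
    moreover have "h p + ereal (1 / (2 * \<alpha>) * (norm (p - x))\<^sup>2) \<le> ereal (\<phi> (p, r))"
      using add_right_mono[OF hp, of "ereal (1 / (2 * \<alpha>) * (norm (p - x))\<^sup>2)"]
      by (simp add: \<phi>_def)
    ultimately show ?thesis by (rule order_trans[rotated])
  next
    case MInf
    then show ?thesis using assms(2) by (simp add: proper_fun_def)
  qed simp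
  then show ?thesis by (auto simp: is_arg_min_def not_less)
qed

lemma proximal_minimizer_finite:
  fixes h :: "'a::real_normed_vector \<Rightarrow> ereal"
  assumes "proper_fun h"
    and p: "is_arg_min (\<lambda>z. h z + ereal (c * (norm (z - x))\<^sup>2)) (\<lambda>_. True) p"
  obtains r where "h p = ereal r"
proof -
  obtain y where y: "h y \<noteq> \<infinity>" using assms(1) by (auto simp: proper_fun_def)
  have "h p + ereal (c * (norm (p - x))\<^sup>2) \<le> h y + ereal (c * (norm (y - x))\<^sup>2)"
    using p by (auto simp: is_arg_min_def not_less)
  then have "h p \<noteq> \<infinity>" using y by auto
  then show ?thesis using assms(1) that by (cases "h p") (auto simp: proper_fun_def)
qed

text \<open>Fermat's rule for the prox subproblem: compare \<open>p\<close> with the points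
  \<open>(1 - t) p + t y\<close>, divide by \<open>t\<close> and let \<open>t\<close> tend to 0.
  This is what turns a bound on subgradients into a bound on the displacement of
  \<open>prox\<close>.\<close>

lemma proximal_minimizer_subgradient:
  fixes h :: "'a::real_inner \<Rightarrow> ereal"
  assumes "proper_fun h" "convex_fun h" "\<alpha> > 0"
    and p: "is_arg_min (\<lambda>z. h z + ereal (1 / (2 * \<alpha>) * (norm (z - x))\<^sup>2)) (\<lambda>_. True) p"
  shows "(1 / \<alpha>) *\<^sub>R (x - p) \<in> subdifferential h p"
proof -
  obtain r where r: "h p = ereal r"
    using proximal_minimizer_finite[OF assms(1) p] .
  have "ereal (r + (1 / \<alpha>) *\<^sub>R (x - p) \<bullet> (y - p)) \<le> h y" for y
  proof (cases "h y")
    case (real s)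
    let ?d = "y - p"
    \<comment> \<open>Convexity bounds \<open>h\<close> on the segment by the chord, so minimality
      of \<open>p\<close> becomes a real inequality. After cancelling the terms at \<open>p\<close>
      and dividing by \<open>t\<close>, only the curvature term keeps a factor
      \<open>t\<close>.\<close>
    have step: "0 \<le> (s - r) + ((p - x) \<bullet> ?d) / \<alpha> + t * ((norm ?d)\<^sup>2 / (2 * \<alpha>))"
      if "0 < t" "t < 1" for t
    proof -
      let ?w = "(1 - t) *\<^sub>R p + t *\<^sub>R y"
      have "(1 - t) *\<^sub>R (p, r) + t *\<^sub>R (y, s) \<in> ext_epigraph h"
        using assms(2) that r real unfolding convex_fun_def
        by (intro convexD_alt[of _ "(p, r)" "(y, s)"]) (auto simp: ext_epigraph_def)
      then have hw: "h ?w \<le> ereal ((1 - t) * r + t * s)"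
        by (simp add: ext_epigraph_def)
      have "ereal (r + 1 / (2 * \<alpha>) * (norm (p - x))\<^sup>2)
              \<le> h ?w + ereal (1 / (2 * \<alpha>) * (norm (?w - x))\<^sup>2)"
        using p r by (auto simp: is_arg_min_def not_less)
      also have "\<dots> \<le> ereal ((1 - t) * r + t * s) + ereal (1 / (2 * \<alpha>) * (norm (?w - x))\<^sup>2)"
        by (intro add_right_mono hw)
      finally have 1: "r + 1 / (2 * \<alpha>) * (norm (p - x))\<^sup>2
          \<le> (1 - t) * r + t * s + 1 / (2 * \<alpha>) * (norm (?w - x))\<^sup>2" by simp
      have "?w - x = (p - x) + t *\<^sub>R ?d" by (simp add: algebra_simps)
      then have "(norm (?w - x))\<^sup>2
          = (norm (p - x))\<^sup>2 + 2 * t * ((p - x) \<bullet> ?d) + t\<^sup>2 * (norm ?d)\<^sup>2"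
        by (simp only: power2_norm_eq_inner inner_add_left inner_add_right
            inner_scaleR_left inner_scaleR_right) (simp add: inner_commute power2_eq_square distrib_left mult.assoc)
      then have "1 / (2 * \<alpha>) * (norm (?w - x))\<^sup>2 = 1 / (2 * \<alpha>) * (norm (p - x))\<^sup>2
          + t * (((p - x) \<bullet> ?d) / \<alpha>) + t * (t * ((norm ?d)\<^sup>2 / (2 * \<alpha>)))"
        using \<open>\<alpha> > 0\<close> by (simp add: field_simps power2_eq_square)
      with 1 have "0 \<le> t * ((s - r) + ((p - x) \<bullet> ?d) / \<alpha> + t * ((norm ?d)\<^sup>2 / (2 * \<alpha>)))"
        by (simp add: algebra_simps)
      then show ?thesis using \<open>0 < t\<close> by (simp add: zero_le_mult_iff)
    qed
    have "((\<lambda>t. (s - r) + ((p - x) \<bullet> ?d) / \<alpha> + t * ((norm ?d)\<^sup>2 / (2 * \<alpha>))) \<longlongrightarrow>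
        (s - r) + ((p - x) \<bullet> ?d) / \<alpha> + 0 * ((norm ?d)\<^sup>2 / (2 * \<alpha>))) (at_right 0)"
      by (intro tendsto_intros)
    then have "0 \<le> (s - r) + ((p - x) \<bullet> ?d) / \<alpha> + 0 * ((norm ?d)\<^sup>2 / (2 * \<alpha>))"
      by (rule tendsto_lowerbound)
        (use step in \<open>auto simp: eventually_at_right_field intro!: exI[of _ 1]\<close>)
    moreover have "(1 / \<alpha>) *\<^sub>R (x - p) \<bullet> ?d = - (((p - x) \<bullet> ?d) / \<alpha>)"
      by (simp add: inner_diff_left diff_divide_distrib)
    ultimately show ?thesis using real by simp
  next
    case MInf
    then show ?thesis using assms(1) by (simp add: proper_fun_def)
  qed simp
  then show ?thesis by (simp add: subdifferential_def r)
qed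

text \<open>Adding the subgradient inequalities at \<open>p\<close> and at \<open>q\<close> cancels
  the values of \<open>h\<close> (monotonicity of the subdifferential); Cauchy-Schwarz
  finishes.\<close>

lemma proximal_minimizer_nonexpansive:
  fixes h :: "'a::real_inner \<Rightarrow> ereal"
  assumes "proper_fun h" "convex_fun h" "\<alpha> > 0"
    and p: "is_arg_min (\<lambda>z. h z + ereal (1 / (2 * \<alpha>) * (norm (z - x))\<^sup>2)) (\<lambda>_. True) p"
    and q: "is_arg_min (\<lambda>z. h z + ereal (1 / (2 * \<alpha>) * (norm (z - y))\<^sup>2)) (\<lambda>_. True) q"
  shows "norm (p - q) \<le> norm (x - y)"
proof -
  obtain r s where rs: "h p = ereal r" "h q = ereal s"
    using proximal_minimizer_finite[OF assms(1) p] proximal_minimizer_finite[OF assms(1) q] by metis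
  have "s \<ge> r + (1 / \<alpha>) *\<^sub>R (x - p) \<bullet> (q - p)" "r \<ge> s + (1 / \<alpha>) *\<^sub>R (y - q) \<bullet> (p - q)"
    using proximal_minimizer_subgradient[OF assms(1-3) p]
      proximal_minimizer_subgradient[OF assms(1-3) q] rs
    unfolding subdifferential_def by (metis (mono_tags, lifting) mem_Collect_eq ereal_less_eq(3) plus_ereal.simps(1))+
  then have "0 \<ge> (1 / \<alpha>) * ((x - p) \<bullet> (q - p) + (y - q) \<bullet> (p - q))"
    by (simp add: algebra_simps add_divide_distrib)
  then have "(x - p) \<bullet> (q - p) + (y - q) \<bullet> (p - q) \<le> 0"
    using \<open>\<alpha> > 0\<close> by (simp add: mult_le_0_iff divide_le_0_iff)
  then have "(p - q) \<bullet> (p - q) \<le> (x - y) \<bullet> (p - q)"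
    by (simp add: inner_diff_left inner_diff_right inner_commute)
  also have "\<dots> \<le> norm (x - y) * norm (p - q)" by (rule norm_cauchy_schwarz)
  finally have "norm (p - q) * norm (p - q) \<le> norm (x - y) * norm (p - q)"
    by (simp add: power2_norm_eq_inner[symmetric] power2_eq_square)
  then show ?thesis
    by (cases "norm (p - q) = 0") (auto dest: mult_right_le_imp_le)
qed

text \<open>\<open>prox\<close> is defined by choice, so its minimality becomes available once some
  minimiser is known to exist.\<close>

lemma prox_is_arg_min:
  assumes "\<exists>p. is_arg_min (\<lambda>z. h z + ereal (1 / (2 * \<alpha>) * (norm (z - x))\<^sup>2)) (\<lambda>_. True) p"
  shows "is_arg_min (\<lambda>z. h z + ereal (1 / (2 * \<alpha>) * (norm (z - x))\<^sup>2)) (\<lambda>_. True) (prox \<alpha> h x)"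
  using someI_ex[OF assms] unfolding prox_def arg_min_def .


section \<open>A minorant from the existence of an optimum\<close>

text \<open>\<open>gradient\<close> is a definite description, so existence and uniqueness are both
  due. The representing vector is the adjoint of the derivative applied to 1; uniqueness is that of
  derivatives.\<close>

lemma GDERIV_gradient:
  fixes f :: "'a::euclidean_space \<Rightarrow> real"
  assumes "f differentiable (at x)"
  shows "GDERIV f x :> gradient f x"
proof -
  obtain f' where f': "(f has_derivative f') (at x)" using assms by (auto simp: differentiable_def)
  then have lin: "linear f'" by (rule has_derivative_linear)
  have "f' = (\<lambda>u. u \<bullet> adjoint f' 1)"
    using adjoint_works[OF lin, of _ 1] by (auto simp: fun_eq_iff inner_commute)
  with f' have ex: "GDERIV f x :> adjoint f' 1" by (simp add: gderiv_def)
  show ?thesis unfolding gradient_def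
  proof (rule theI[of _ "adjoint f' 1"])
    fix D assume "GDERIV f x :> D"
    with ex have "(\<lambda>u. u \<bullet> D) = (\<lambda>u. u \<bullet> adjoint f' 1)"
      unfolding gderiv_def by (rule has_derivative_unique[rotated])
    then show "D = adjoint f' 1" by (metis inner_commute vector_eq_rdot)
  qed (rule ex)
qed

text \<open>Mean value inequality; Cauchy-Schwarz bounds the operator norm of the derivative by the
  norm of the gradient.\<close>

lemma bounded_gradient_Lipschitz:
  fixes f :: "'a::euclidean_space \<Rightarrow> real"
  assumes "\<And>y. f differentiable (at y)" "\<And>y. norm (gradient f y) \<le> G"
  shows "\<bar>f y - f x\<bar> \<le> G * norm (y - x)"
proof -
  have "norm (f y - f x) \<le> G * norm (y - x)"
  proof (rule differentiable_bound[of UNIV f "\<lambda>z u. u \<bullet> gradient f z"])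
    fix z :: 'a
    show "(f has_derivative (\<lambda>u. u \<bullet> gradient f z)) (at z within UNIV)"
      using GDERIV_gradient[OF assms(1)] by (simp add: gderiv_def)
    show "onorm (\<lambda>u. u \<bullet> gradient f z) \<le> G"
    proof (rule onorm_le)
      fix u :: 'a
      have "norm (u \<bullet> gradient f z) \<le> norm u * norm (gradient f z)"
        using Cauchy_Schwarz_ineq2 by simp
      also have "\<dots> \<le> norm u * G" by (intro mult_left_mono assms(2)) simp
      finally show "norm (u \<bullet> gradient f z) \<le> G * norm u" by (simp add: mult.commute)
    qed
  qed auto
  then show ?thesis by simp
qed

lemma objective_finite:
  fixes g :: "'m::finite \<Rightarrow> 'a \<Rightarrow> real"
  assumes "h y = ereal r"
  shows "objective g h y = ereal ((1 / real CARD('m)) * (\<Sum>i\<in>UNIV. g i y) + r)"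
  by (simp add: objective_def assms sum.distrib field_simps)

text \<open>By optimality of \<open>w\<close>, \<open>h\<close> can drop from \<open>w\<close> to
  \<open>z\<close> by at most the rise of the mean of the \<open>g i\<close>, hence by at most
  \<open>G * norm (z - w)\<close>. The triangle inequality moves the centre from \<open>w\<close> to
  \<open>x\<close>, and the constant \<open>a\<close> absorbs the cost.\<close>

lemma optimum_minorant:
  fixes g :: "'m::finite \<Rightarrow> 'a::real_normed_vector \<Rightarrow> real"
  assumes "proper_fun h" "is_arg_min (objective g h) (\<lambda>_. True) w"
    and Lip: "\<And>i y z. \<bar>g i y - g i z\<bar> \<le> G * norm (y - z)"
  shows "\<exists>a. \<forall>z. ereal (a - G * norm (z - x)) \<le> h z"
proof -
  have min: "objective g h w \<le> objective g h z" for z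
    using assms(2) by (auto simp: is_arg_min_def not_less)
  obtain y r\<^sub>y where y: "h y = ereal r\<^sub>y"
    using assms(1) unfolding proper_fun_def by (metis ereal_cases)
  have "h w \<noteq> \<infinity>"
  proof
    assume "h w = \<infinity>"
    then have "objective g h w = \<infinity>" by (simp add: objective_def sum_Pinfty)
    with min[of y] show False by (simp add: objective_finite[where h = h, OF y])
  qed
  then obtain r where r: "h w = ereal r"
    using assms(1) by (cases "h w") (auto simp: proper_fun_def)
  have "ereal (r - G * norm (x - w) - G * norm (z - x)) \<le> h z" for z
  proof (cases "h z")
    case (real s)
    have "(1 / real CARD('m)) * (\<Sum>i\<in>UNIV. g i z) - (1 / real CARD('m)) * (\<Sum>i\<in>UNIV. g i w)
        = (1 / real CARD('m)) * (\<Sum>i\<in>UNIV. g i z - g i w)"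
      by (simp add: sum_subtractf diff_divide_distrib)
    also have "\<dots> \<le> (1 / real CARD('m)) * (\<Sum>i\<in>(UNIV::'m set). G * norm (z - w))"
      by (intro mult_left_mono sum_mono) (use Lip[of _ z w] in \<open>auto simp: abs_le_iff\<close>)
    also have "\<dots> = G * norm (z - w)" by simp
    finally have "r \<le> s + G * norm (z - w)"
      using min[of z] by (simp add: objective_finite[where h = h, OF r] objective_finite[where h = h, OF real])
    \<comment> \<open>For \<open>z = x\<close> both sides agree. Otherwise the Lipschitz bound
      between \<open>z\<close> and \<open>x\<close>, for an arbitrary agent, forces
      \<open>G \<ge> 0\<close>.\<close>
    moreover have "G * norm (z - w) \<le> G * norm (z - x) + G * norm (x - w)"
    proof (cases "z = x")
      case False
      then have "G \<ge> 0" using order_trans[OF abs_ge_zero Lip[of undefined z x]]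
        by (auto simp: zero_le_mult_iff)
      then have "G * norm (z - w) \<le> G * (norm (z - x) + norm (x - w))"
        by (intro mult_left_mono) (use norm_triangle_ineq[of "z - x" "x - w"] in auto)
      then show ?thesis by (simp add: algebra_simps)
    qed simp
    ultimately show ?thesis using real by simp
  next
    case MInf
    then show ?thesis using assms(1) by (simp add: proper_fun_def)
  qed simp
  then show ?thesis by blast
qed


section \<open>Products of stochastic matrices\<close>

lemma doubly_stochastic_mult:
  fixes P Q :: "real^'m^'m::finite"
  assumes "doubly_stochastic P" "doubly_stochastic Q"
  shows "doubly_stochastic (P ** Q)"
proof -
  have "(\<Sum>j\<in>UNIV. \<Sum>k\<in>UNIV. P $ i $ k * Q $ k $ j) = 1" for i
    using assms by (subst sum.swap) (simp add: doubly_stochastic_def sum_distrib_left[symmetric])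
  moreover have "(\<Sum>i\<in>UNIV. \<Sum>k\<in>UNIV. P $ i $ k * Q $ k $ j) = 1" for j
    using assms by (subst sum.swap) (simp add: doubly_stochastic_def sum_distrib_right[symmetric])
  ultimately show ?thesis
    using assms by (auto simp: doubly_stochastic_def matrix_matrix_mult_def intro!: sum_nonneg)
qed

text \<open>The dummy value for \<open>t < s\<close> is \<open>A s\<close>, so that case is covered
  as well.\<close>

lemma doubly_stochastic_transition:
  fixes A :: "nat \<Rightarrow> real^'m^'m::finite"
  assumes "\<And>t. t \<ge> 1 \<Longrightarrow> doubly_stochastic (A t)" "s \<ge> 1"
  shows "doubly_stochastic (transition A t s)"
  using assms by (induction t) (auto intro: doubly_stochastic_mult)

lemma transition_split:
  assumes "s \<le> r" "r < t"
  shows "transition A t s = transition A t (Suc r) ** transition A r s"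
  using assms
proof (induction t)
  case (Suc t)
  then show ?case
    by (cases "r = t") (auto simp: matrix_mul_assoc)
qed simp

text \<open>A direct link at some time suffices, since the weight can wait on the diagonal before and
  after it; no path through intermediate agents is needed under all-to-all communication.\<close>

lemma transition_entry_ge:
  fixes A :: "nat \<Rightarrow> real^'m^'m::finite"
  assumes ds: "\<And>t. t \<ge> 1 \<Longrightarrow> doubly_stochastic (A t)" and "s \<ge> 1" "s \<le> t" "\<eta> \<ge> 0"
    and diag: "\<And>t i. t \<ge> 1 \<Longrightarrow> A t $ i $ i \<ge> \<eta>"
    and link: "i = j \<or> (\<exists>u\<in>{s..t}. A u $ i $ j \<ge> \<eta>)"
  shows "transition A t s $ i $ j \<ge> \<eta> ^ Suc (t - s)"
  using \<open>s \<le> t\<close> link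
proof (induction t arbitrary: i)
  case 0
  then show ?case using \<open>s \<ge> 1\<close> by simp
next
  case (Suc t)
  show ?case
  proof (cases "s \<le> t")
    case False
    with Suc.prems have "s = Suc t" by simp
    then show ?thesis using Suc.prems diag[of s i] \<open>s \<ge> 1\<close> by auto
  next
    case True
    have nonneg: "A (Suc t) $ i $ l \<ge> 0" "transition A t s $ l $ j \<ge> 0" for l
      using ds[of "Suc t"] doubly_stochastic_transition[of A s t, OF ds \<open>s \<ge> 1\<close>]
      by (auto simp: doubly_stochastic_def)
    have via: "A (Suc t) $ i $ l * transition A t s $ l $ j \<le> transition A (Suc t) s $ i $ j" for l
      using True nonneg member_le_sum[of l UNIV "\<lambda>l. A (Suc t) $ i $ l * transition A t s $ l $ j"]
      by (simp add: matrix_matrix_mult_def)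
    \<comment> \<open>Index \<open>l\<close> is where the newest factor is entered: it stays at
      \<open>i\<close> if the remaining factors already lead from \<open>i\<close> to
      \<open>j\<close>, and is \<open>j\<close> if the direct link occurs at time
      \<open>Suc t\<close>.\<close>
    obtain l where l: "A (Suc t) $ i $ l \<ge> \<eta>" "l = j \<or> (\<exists>u\<in>{s..t}. A u $ l $ j \<ge> \<eta>)"
    proof (cases "i = j \<or> (\<exists>u\<in>{s..t}. A u $ i $ j \<ge> \<eta>)")
      case True
      then show ?thesis using that[of i] diag[of "Suc t" i] by auto
    next
      case False
      then have "A (Suc t) $ i $ j \<ge> \<eta>"
        using Suc.prems by (auto simp: atLeastAtMostSuc_conv)
      then show ?thesis using that[of j] by auto
    qed
    have "\<eta> ^ Suc (Suc t - s) = \<eta> * \<eta> ^ Suc (t - s)"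
      using True by (simp add: Suc_diff_le)
    also have "\<dots> \<le> A (Suc t) $ i $ l * transition A t s $ l $ j"
      using l True \<open>\<eta> \<ge> 0\<close> nonneg by (intro mult_mono Suc.IH) auto
    finally show ?thesis using via[of l] by linarith
  qed
qed

text \<open>Each row of \<open>P\<close> averages column \<open>l\<close> of \<open>Q\<close>.
  Measured from the smallest entry, at index \<open>k\<close>, that entry contributes 0, and the
  remaining mass of at most \<open>1 - \<delta>\<close> meets values of at most \<open>D\<close>. No
  average falls below the minimum.\<close>

lemma stochastic_mult_spread:
  fixes P Q :: "real^'m^'m::finite"
  assumes P: "doubly_stochastic P" "\<And>i j. P $ i $ j \<ge> \<delta>"
    and D: "\<And>i j. Q $ i $ l - Q $ j $ l \<le> D"
  shows "(P ** Q) $ i $ l - (P ** Q) $ j $ l \<le> (1 - \<delta>) * D"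
proof -
  obtain k where k: "\<And>i. Q $ k $ l \<le> Q $ i $ l"
    using ex_is_arg_min_if_finite[of "UNIV::'m set" "\<lambda>i. Q $ i $ l"]
    by (auto simp: is_arg_min_def not_less)
  have D0: "D \<ge> 0" using D[of k k] by simp
  have row: "(\<Sum>r\<in>UNIV. P $ i $ r) = 1" "P $ i $ r \<ge> 0" for i r
    using P(1) by (auto simp: doubly_stochastic_def)
  have eq: "(P ** Q) $ i $ l = Q $ k $ l + (\<Sum>r\<in>UNIV. P $ i $ r * (Q $ r $ l - Q $ k $ l))" for i
    using row(1)[of i]
    by (simp add: matrix_matrix_mult_def right_diff_distrib sum_subtractf sum_distrib_right[symmetric])
  have "(\<Sum>r\<in>UNIV. P $ i $ r * (Q $ r $ l - Q $ k $ l))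
      = (\<Sum>r\<in>UNIV - {k}. P $ i $ r * (Q $ r $ l - Q $ k $ l))"
    by (subst sum.remove[of UNIV k]) auto
  also have "\<dots> \<le> (\<Sum>r\<in>UNIV - {k}. P $ i $ r * D)"
    using D row by (intro sum_mono mult_left_mono) auto
  also have "\<dots> = (1 - P $ i $ k) * D"
    using row(1)[of i] sum.remove[of UNIV k "\<lambda>r. P $ i $ r"] by (simp add: sum_distrib_right[symmetric])
  also have "\<dots> \<le> (1 - \<delta>) * D"
    using P(2)[of i k] D0 by (intro mult_right_mono) auto
  finally have "(P ** Q) $ i $ l \<le> Q $ k $ l + (1 - \<delta>) * D" using eq[of i] by simp
  moreover have "(P ** Q) $ j $ l \<ge> Q $ k $ l"
    unfolding eq[of j] using k row by (simp add: sum_nonneg)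
  ultimately show ?thesis by linarith
qed

text \<open>The product has \<open>n + 1\<close> factors. The oldest one, \<open>A s\<close>, serves
  as the starting matrix; the other \<open>n\<close> contain \<open>n div B\<close> complete blocks,
  each contracting the spread by \<open>1 - \<delta>\<close>.\<close>

lemma transition_spread:
  fixes A :: "nat \<Rightarrow> real^'m^'m::finite"
  assumes ds: "\<And>t. t \<ge> 1 \<Longrightarrow> doubly_stochastic (A t)" and "s \<ge> 1" "B \<ge> 1"
    and block: "\<And>r i j. r \<ge> 1 \<Longrightarrow> transition A (r + B - 1) r $ i $ j \<ge> \<delta>"
  shows "transition A (s + n) s $ i $ l - transition A (s + n) s $ j $ l \<le> (1 - \<delta>) ^ (n div B)"
proof -
  have blocks: "transition A (s + c * B) s $ i $ l - transition A (s + c * B) s $ j $ l \<le> (1 - \<delta>) ^ c"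
    for c i j
  proof (induction c arbitrary: i j)
    case 0
    have S: "doubly_stochastic (transition A s s)"
      by (rule doubly_stochastic_transition[OF ds \<open>s \<ge> 1\<close>])
    \<comment> \<open>Entries of a stochastic matrix lie between 0 and 1, so the initial spread is
      at most 1.\<close>
    have "transition A s s $ i $ l \<le> (\<Sum>l\<in>UNIV. transition A s s $ i $ l)"
      using S by (intro member_le_sum) (auto simp: doubly_stochastic_def)
    then show ?case using S
      by (simp add: doubly_stochastic_def) (smt (verit))
  next
    case (Suc c)
    let ?r = "s + c * B"
    have "transition A (s + Suc c * B) s = transition A (Suc ?r + B - 1) (Suc ?r) ** transition A ?r s"
      using \<open>B \<ge> 1\<close> transition_split[of s ?r "s + Suc c * B" A] by (simp add: ac_simps)
    moreover have "doubly_stochastic (transition A (Suc ?r + B - 1) (Suc ?r))"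
      by (rule doubly_stochastic_transition[OF ds]) auto
    ultimately show ?case
      using stochastic_mult_spread[OF _ block[of "Suc ?r"] Suc.IH, of i j] by simp
  qed
  have n: "n = n div B * B + n mod B" by simp
  let ?r = "s + n div B * B"
  show ?thesis
  proof (cases "n mod B = 0")
    case True
    with n have "s + n = ?r" by simp
    then show ?thesis using blocks[of "n div B" i j] by simp
  next
    \<comment> \<open>The incomplete last block is only known to have nonnegative entries;
      contraction with \<open>\<delta> = 0\<close> shows that it does not increase the
      spread.\<close>
    case False
    with n have "?r < s + n" by linarith
    then have "transition A (s + n) s = transition A (s + n) (Suc ?r) ** transition A ?r s"
      by (intro transition_split) auto
    moreover have "doubly_stochastic (transition A (s + n) (Suc ?r))"
      by (rule doubly_stochastic_transition[OF ds]) auto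
    ultimately show ?thesis
      using stochastic_mult_spread[of "transition A (s + n) (Suc ?r)" 0 "transition A ?r s" l
          "(1 - \<delta>) ^ (n div B)" i j] blocks
      by (simp add: doubly_stochastic_def)
  qed
qed

text \<open>The network is constrained from time 1 on, while \<open>comm_steps 1 = 0\<close>. The
  algorithm uses the weights at \<open>k + 1\<close> with \<open>k \<ge> 1\<close>, so
  \<open>k \<ge> 2\<close> is the relevant range.\<close>

lemma comm_steps_pos: "k \<ge> 2 \<Longrightarrow> comm_steps k \<ge> 1"
  unfolding comm_steps_def using member_le_sum[of 1 "{1..k - 1}" "\<lambda>l. l"] by simp


section \<open>Convergence\<close>

text \<open>With \<open>r\<close> the \<open>B\<close>-th root of \<open>\<rho>\<close>,
  \<open>k \<le> B * (k div B) + B\<close> gives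
  \<open>\<rho> ^ (k div B) \<le> r ^ k / \<rho>\<close>, a true geometric sequence in
  \<open>k\<close>, and \<open>k * r ^ k\<close> tends to 0.\<close>

lemma linear_times_power_div_tendsto_0:
  fixes \<rho> a c :: real
  assumes "0 < \<rho>" "\<rho> < 1" "B \<ge> 1"
  shows "(\<lambda>k. \<rho> ^ (k div B) * (a + real k * c)) \<longlonglongrightarrow> 0"
proof -
  define r where "r = root B \<rho>"
  have r: "0 < r" "r < 1" "r ^ B = \<rho>" using assms by (auto simp: r_def real_root_pow_pos2)
  have bound: "\<rho> ^ (k div B) \<le> r ^ k / \<rho>" for k
  proof -
    have "k \<le> B * (k div B) + B"
      using assms(3) mult_div_mod_eq[of B k] mod_less_divisor[of B k] by linarith
    then have "r ^ (B * (k div B) + B) \<le> r ^ k" using r by (intro power_decreasing) auto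
    then show ?thesis using r assms by (simp add: power_add power_mult field_simps)
  qed
  have "(\<lambda>k. (\<bar>a\<bar> * r ^ k + (real k * r ^ k) * \<bar>c\<bar>) / \<rho>) \<longlonglongrightarrow> (\<bar>a\<bar> * 0 + 0 * \<bar>c\<bar>) / \<rho>"
    using r assms by (intro tendsto_intros LIMSEQ_power_zero powser_times_n_limit_0) auto
  then have "(\<lambda>k. (\<bar>a\<bar> * r ^ k + (real k * r ^ k) * \<bar>c\<bar>) / \<rho>) \<longlonglongrightarrow> 0" by simp
  then show ?thesis
  proof (rule Lim_null_comparison[rotated], intro always_eventually allI)
    fix k
    have "norm (\<rho> ^ (k div B) * (a + real k * c)) = \<rho> ^ (k div B) * \<bar>a + real k * c\<bar>"
      using assms by (simp add: abs_mult)
    also have "\<dots> \<le> (r ^ k / \<rho>) * (\<bar>a\<bar> + real k * \<bar>c\<bar>)"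
      using r assms bound abs_triangle_ineq[of a "real k * c"]
      by (intro mult_mono) (auto simp: abs_mult)
    also have "\<dots> = (\<bar>a\<bar> * r ^ k + (real k * r ^ k) * \<bar>c\<bar>) / \<rho>"
      by (simp add: field_simps)
    finally show "norm (\<rho> ^ (k div B) * (a + real k * c)) \<le> \<dots>" .
  qed
qed

text \<open>The deviation from the mean is the mean of the pairwise differences, so pairwise bounds
  suffice.\<close>

lemma norm_diff_agent_mean_le:
  fixes x :: "'m::finite \<Rightarrow> nat \<Rightarrow> 'a::real_normed_vector"
  assumes "\<And>j. norm (x i k - x j k) \<le> D"
  shows "norm (x i k - agent_mean x k) \<le> D"
proof -
  have "x i k - agent_mean x k = (1 / real CARD('m)) *\<^sub>R (\<Sum>j\<in>UNIV. x i k - x j k)"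
    by (simp add: agent_mean_def sum_subtractf scaleR_diff_right sum_constant_scaleR del: sum_constant)
  also have "norm \<dots> = (1 / real CARD('m)) * norm (\<Sum>j\<in>UNIV. x i k - x j k)" by simp
  also have "\<dots> \<le> (1 / real CARD('m)) * (\<Sum>j\<in>(UNIV::'m set). D)"
    by (intro mult_left_mono sum_norm_le assms) auto
  finally show ?thesis by simp
qed

theorem mainTheorem1:
  fixes g :: "'m::finite \<Rightarrow> real^'n \<Rightarrow> real"
    and h :: "real^'n \<Rightarrow> ereal"
    and L G\<^sub>g G\<^sub>h \<eta> \<alpha> :: real
    and E :: "nat \<Rightarrow> 'm set set"
    and A :: "nat \<Rightarrow> real^'m^'m"
    and B :: nat
    and x q v :: "'m \<Rightarrow> nat \<Rightarrow> real^'n"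
  assumes h_closed_proper: "closed_fun h" "proper_fun h"
    and g_C1: "\<And>i y. g i differentiable (at y)" "\<And>i. continuous_on UNIV (gradient (g i))"
    and L_pos: "L > 0"
    and grad_Lipschitz: "\<And>i y z. norm (gradient (g i) y - gradient (g i) z) \<le> L * norm (y - z)"
    and h_convex: "convex_fun h"
    and grad_bounded: "\<And>i y. norm (gradient (g i) y) < G\<^sub>g"
    and subgrad_bounded: "\<And>y z. z \<in> subdifferential h y \<Longrightarrow> norm z < G\<^sub>h"
    and optimum_exists: "\<exists>x_opt. is_arg_min (objective g h) (\<lambda>_. True) x_opt"
    and edges_undirected: "\<And>t e. t \<ge> 1 \<Longrightarrow> e \<in> E t \<Longrightarrow> \<exists>i j. e = {i, j}"
    and A_symmetric: "\<And>t. t \<ge> 1 \<Longrightarrow> transpose (A t) = A t"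
    and A_doubly_stochastic: "\<And>t. t \<ge> 1 \<Longrightarrow> doubly_stochastic (A t)"
    and eta_range: "0 < \<eta>" "\<eta> < 1"
    and A_diag: "\<And>t i. t \<ge> 1 \<Longrightarrow> A t $ i $ i \<ge> \<eta>"
    and A_edge: "\<And>t i j. t \<ge> 1 \<Longrightarrow> i \<noteq> j \<Longrightarrow> {i, j} \<in> E t \<Longrightarrow> A t $ i $ j \<ge> \<eta>"
    and A_nonedge: "\<And>t i j. t \<ge> 1 \<Longrightarrow> i \<noteq> j \<Longrightarrow> {i, j} \<notin> E t \<Longrightarrow> A t $ i $ j = 0"
    and infinitely_often: "\<And>i j. i \<noteq> j \<Longrightarrow> infinite {t. t \<ge> 1 \<and> {i, j} \<in> E t}"
    and B_ge_1: "B \<ge> 1"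
    and within_B: "\<And>i j t. i \<noteq> j \<Longrightarrow> t \<ge> 1 \<Longrightarrow> \<exists>s\<in>{t..t + B - 1}. {i, j} \<in> E s"
    and step_size: "0 < \<alpha>" "\<alpha> < 1 / L"
    and q_step: "\<And>i k. k \<ge> 1 \<Longrightarrow> q i (k + 1) = x i k - \<alpha> *\<^sub>R gradient (g i) (x i k)"
    and v_step: "\<And>i k. k \<ge> 1 \<Longrightarrow> v i (k + 1) = (\<Sum>j\<in>UNIV. weight A i j (k + 1) *\<^sub>R q j (k + 1))"
    and x_step: "\<And>i k. k \<ge> 1 \<Longrightarrow> x i (k + 1) = prox \<alpha> h (v i (k + 1))"
  shows "\<forall>i. (\<lambda>k. norm (x i k - agent_mean x k)) \<longlonglongrightarrow> 0"
proof -

  \<comment> \<open>Existence and displacement of proximal points\<close>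
  have Lip: "\<bar>g i y - g i z\<bar> \<le> G\<^sub>g * norm (y - z)" for i y z
    by (rule bounded_gradient_Lipschitz[OF g_C1(1)]) (use grad_bounded less_imp_le in blast)
  obtain w where w: "is_arg_min (objective g h) (\<lambda>_. True) w"
    using optimum_exists ..
  have prox: "is_arg_min (\<lambda>z. h z + ereal (1 / (2 * \<alpha>) * (norm (z - y))\<^sup>2)) (\<lambda>_. True) (prox \<alpha> h y)"
    for y
  proof -
    obtain a where "\<And>z. ereal (a - G\<^sub>g * norm (z - y)) \<le> h z"
      using optimum_minorant[OF h_closed_proper(2) w Lip] by blast
    then show ?thesis
      by (intro prox_is_arg_min prox_minimizer_exists[OF h_closed_proper step_size(1)])
  qed
  have prox_dist: "norm (prox \<alpha> h y - y) \<le> \<alpha> * G\<^sub>h" for y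
  proof -
    have "norm ((1 / \<alpha>) *\<^sub>R (y - prox \<alpha> h y)) < G\<^sub>h"
      by (rule subgrad_bounded[OF proximal_minimizer_subgradient[OF h_closed_proper(2) h_convex step_size(1) prox]])
    then show ?thesis
      using step_size(1) unfolding norm_scaleR by (simp add: field_simps norm_minus_commute)
  qed
  have weights: "doubly_stochastic (transition A (comm_steps k + k) (comm_steps k))" if "k \<ge> 2" for k
    by (rule doubly_stochastic_transition[OF A_doubly_stochastic comm_steps_pos[OF that]])

  \<comment> \<open>Linear growth of the iterates\<close>
  define R where "R = (\<Sum>i\<in>UNIV. norm (x i 1))"
  \<comment> \<open>The growth allowed per iteration: \<open>\<alpha> * G\<^sub>g\<close> for the
    gradient step and \<open>\<alpha> * G\<^sub>h\<close> for the proximal step.\<close>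
  define c where "c = \<alpha> * G\<^sub>g + \<alpha> * G\<^sub>h"
  have c: "c \<ge> 0"
    using order_trans[OF norm_ge_zero prox_dist] step_size(1)
      le_less_trans[OF norm_ge_zero grad_bounded] by (simp add: c_def less_imp_le)
  have q_le: "norm (q i (k + 1)) \<le> norm (x i k) + \<alpha> * G\<^sub>g" if "k \<ge> 1" for i k
  proof -
    have "norm (q i (k + 1)) \<le> norm (x i k) + norm (\<alpha> *\<^sub>R gradient (g i) (x i k))"
      unfolding q_step[OF that] by (rule norm_triangle_ineq4)
    also have "norm (\<alpha> *\<^sub>R gradient (g i) (x i k)) \<le> \<alpha> * G\<^sub>g"
      using step_size(1) grad_bounded[of i "x i k"] by simp
    finally show ?thesis by simp
  qed
  \<comment> \<open>The bound is uniform in the agent, so mixing with nonnegative weights of row sum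
    1 preserves it; only the gradient and proximal steps add to it.\<close>
  have x_le: "norm (x i k) \<le> R + real k * c" if "k \<ge> 1" for i k
    using that
  proof (induction k arbitrary: i rule: dec_induct)
    case base
    have "norm (x i 1) \<le> R" unfolding R_def by (rule member_le_sum) auto
    then show ?case using c by simp
  next
    case (step k)
    have W: "weight A i j (k + 1) \<ge> 0" "(\<Sum>j\<in>UNIV. weight A i j (k + 1)) = 1" for j
      using weights[of "k + 1"] step by (auto simp: weight_def doubly_stochastic_def)
    have "norm (v i (k + 1)) \<le> (\<Sum>j\<in>UNIV. weight A i j (k + 1) * (R + real k * c + \<alpha> * G\<^sub>g))"
      unfolding v_step[OF step(1)]
    proof (rule sum_norm_le)
      fix j
      have "norm (q j (k + 1)) \<le> R + real k * c + \<alpha> * G\<^sub>g"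
        using q_le[OF step(1), of j] step.IH[of j] by linarith
      then show "norm (weight A i j (k + 1) *\<^sub>R q j (k + 1))
          \<le> weight A i j (k + 1) * (R + real k * c + \<alpha> * G\<^sub>g)"
        using W by (simp add: mult_left_mono)
    qed
    also have "\<dots> = R + real k * c + \<alpha> * G\<^sub>g"
      using W by (simp add: sum_distrib_right[symmetric])
    finally have "norm (v i (k + 1)) \<le> R + real k * c + \<alpha> * G\<^sub>g" .
    moreover have "norm (x i (k + 1)) \<le> norm (v i (k + 1)) + \<alpha> * G\<^sub>h"
      unfolding x_step[OF step(1)]
      using prox_dist[of "v i (k + 1)"] norm_triangle_sub[of "prox \<alpha> h (v i (k + 1))" "v i (k + 1)"]
      by linarith
    ultimately show ?case by (simp add: c_def algebra_simps)
  qed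

  \<comment> \<open>Geometric decay of the weight spread\<close>
  define \<rho> where "\<rho> = 1 - \<eta> ^ B"
  have \<rho>: "0 < \<rho>" "\<rho> < 1"
    using eta_range B_ge_1 by (auto simp: \<rho>_def power_less_one_iff)
  have block: "transition A (r + B - 1) r $ i $ j \<ge> \<eta> ^ B" if "r \<ge> 1" for r i j
  proof -
    have "i = j \<or> (\<exists>u\<in>{r..r + B - 1}. A u $ i $ j \<ge> \<eta>)"
      using within_B[of i j r] A_edge[of _ i j] that by (metis atLeastAtMost_iff order_trans)
    then have "transition A (r + B - 1) r $ i $ j \<ge> \<eta> ^ Suc (r + B - 1 - r)"
      using that B_ge_1 eta_range A_diag
      by (intro transition_entry_ge[OF A_doubly_stochastic]) auto
    then show ?thesis using B_ge_1 by simp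
  qed
  \<comment> \<open>The product defining the weights at iteration \<open>k\<close> starts at
    \<open>comm_steps k\<close> and has \<open>k + 1\<close> factors, so the spread bound applies
    with \<open>n = k\<close>. Exchanging \<open>i\<close> and \<open>j\<close> yields the absolute
    value.\<close>
  have weight_diff: "\<bar>weight A i l k - weight A j l k\<bar> \<le> \<rho> ^ (k div B)" if "k \<ge> 2" for i j l k
    using transition_spread[OF A_doubly_stochastic comm_steps_pos[OF that] B_ge_1 block, of k i l j]
      transition_spread[OF A_doubly_stochastic comm_steps_pos[OF that] B_ge_1 block, of k j l i]
    by (simp add: weight_def \<rho>_def)

  \<comment> \<open>Vanishing pairwise distances\<close>
  define \<epsilon> where "\<epsilon> = (\<lambda>k. real CARD('m) * (\<rho> ^ (k div B) * (R + \<alpha> * G\<^sub>g + real k * c)))"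
  have x_diff: "norm (x i (k + 1) - x j (k + 1)) \<le> \<epsilon> (k + 1)" if "k \<ge> 1" for i j k
  proof -
    have "norm (x i (k + 1) - x j (k + 1)) \<le> norm (v i (k + 1) - v j (k + 1))"
      unfolding x_step[OF that]
      by (rule proximal_minimizer_nonexpansive[OF h_closed_proper(2) h_convex step_size(1) prox prox])
    \<comment> \<open>Both agents mix the same vectors \<open>q l (k + 1)\<close>, so only weight
      differences remain and a linear bound on these vectors is enough.\<close>
    also have "v i (k + 1) - v j (k + 1)
        = (\<Sum>l\<in>UNIV. (weight A i l (k + 1) - weight A j l (k + 1)) *\<^sub>R q l (k + 1))"
      unfolding v_step[OF that] by (simp add: sum_subtractf scaleR_diff_left)
    also have "norm \<dots> \<le> (\<Sum>l\<in>(UNIV::'m set).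
        \<rho> ^ ((k + 1) div B) * (R + \<alpha> * G\<^sub>g + real (k + 1) * c))"
    proof (rule sum_norm_le)
      fix l
      \<comment> \<open>Since \<open>c \<ge> 0\<close>, the factor \<open>k\<close> may be raised to
        \<open>k + 1\<close>, which aligns the bound with the index of
        \<open>\<epsilon>\<close>.\<close>
      have "norm (q l (k + 1)) \<le> R + \<alpha> * G\<^sub>g + real (k + 1) * c"
        using q_le[OF that, of l] x_le[OF that, of l] c by (simp add: algebra_simps)
      then show "norm ((weight A i l (k + 1) - weight A j l (k + 1)) *\<^sub>R q l (k + 1))
          \<le> \<rho> ^ ((k + 1) div B) * (R + \<alpha> * G\<^sub>g + real (k + 1) * c)"
        using weight_diff[of "k + 1" i l j] that \<rho> unfolding norm_scaleR real_norm_def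
        by (intro mult_mono) auto
    qed
    finally show ?thesis by (simp add: \<epsilon>_def)
  qed
  have "\<epsilon> \<longlonglongrightarrow> 0"
    unfolding \<epsilon>_def using tendsto_mult_left[OF linear_times_power_div_tendsto_0[OF \<rho> B_ge_1]] by fastforce
  show ?thesis
  proof
    fix i
    have "\<forall>\<^sub>F k in sequentially. norm (norm (x i k - agent_mean x k)) \<le> \<epsilon> k"
    proof (rule eventually_sequentiallyI[of 2])
      fix k :: nat assume "k \<ge> 2"
      then have "norm (x i k - x j k) \<le> \<epsilon> k" for j
        using x_diff[of "k - 1" i j] by simp
      then show "norm (norm (x i k - agent_mean x k)) \<le> \<epsilon> k"
        using norm_diff_agent_mean_le[of x i k "\<epsilon> k"] by simp
    qed
    then show "(\<lambda>k. norm (x i k - agent_mean x k)) \<longlonglongrightarrow> 0"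
      using \<open>\<epsilon> \<longlonglongrightarrow> 0\<close> by (rule Lim_null_comparison)
  qed
qed

end
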